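(* Every locally minimal SIN group $G$ which is NSnS is metrizable.
   Context: Groups are written additively but are not necessarily abelian; $0$ is the neutral element; $\mathcal V(0)$ is the filter of (not necessarily open) neighborhoods of $0$. A Hausdorff topological group $(G,\tau)$ is locally minimal if there exists a neighborhood $V$ of $0$ such that whenever $\sigma\le\tau$ is a Hausdorff group topology on $G$ such that $V$ is a $\sigma$-neighborhood of $0$, then $\sigma=\tau$. A topological group $G$ is a SIN group if for every $U\in\mathcal V(0)$ there exists $V\in\mathcal V(0)$ with $-x+V+x\subseteq U$ for all $x\in G$. A topological group is NSnS (No Small normal Subgroups) if some neighborhood of $0$ contains no normal subgroup other than the trivial one. *)

theory Defs
  imports "HOL-Algebra.Coset" "HOL-Analysis.Abstract_Metric_Spaces"
begin

text \<open>
  Groups are those of HOL-Algebra, which are not assumed abelian and are written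
  multiplicatively: \<open>\<one>\<^bsub>G\<^esub>\<close> is the neutral element \<open>0\<close>, and \<open>-x + v + x\<close> becomes
  \<open>inv\<^bsub>G\<^esub> x \<otimes>\<^bsub>G\<^esub> v \<otimes>\<^bsub>G\<^esub> x\<close>.
  Topologies are values of type \<open>'a topology\<close>, so that several of them can be
  compared on the same group.
\<close>

definition group_topology :: "('a, 'b) monoid_scheme \<Rightarrow> 'a topology \<Rightarrow> bool" where
  "group_topology G T \<longleftrightarrow>
     topspace T = carrier G \<and>
     continuous_map (prod_topology T T) T (\<lambda>(x, y). x \<otimes>\<^bsub>G\<^esub> y) \<and>
     continuous_map T T (\<lambda>x. inv\<^bsub>G\<^esub> x)"

definition topological_group :: "('a, 'b) monoid_scheme \<Rightarrow> 'a topology \<Rightarrow> bool" where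
  "topological_group G T \<longleftrightarrow> group G \<and> group_topology G T"

text \<open>Neighborhoods of the neutral element; they need not be open.\<close>

definition nbhds_one :: "('a, 'b) monoid_scheme \<Rightarrow> 'a topology \<Rightarrow> 'a set set" where
  "nbhds_one G T =
     {V. V \<subseteq> carrier G \<and> (\<exists>W. openin T W \<and> \<one>\<^bsub>G\<^esub> \<in> W \<and> W \<subseteq> V)}"

definition coarser_topology :: "'a topology \<Rightarrow> 'a topology \<Rightarrow> bool" where
  "coarser_topology S T \<longleftrightarrow> (\<forall>U. openin S U \<longrightarrow> openin T U)"

definition locally_minimal_group :: "('a, 'b) monoid_scheme \<Rightarrow> 'a topology \<Rightarrow> bool" where
  "locally_minimal_group G T \<longleftrightarrow>
     topological_group G T \<and> Hausdorff_space T \<and>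
     (\<exists>V \<in> nbhds_one G T. \<forall>S.
        group_topology G S \<and> Hausdorff_space S \<and> coarser_topology S T \<and> V \<in> nbhds_one G S
        \<longrightarrow> S = T)"

definition SIN_group :: "('a, 'b) monoid_scheme \<Rightarrow> 'a topology \<Rightarrow> bool" where
  "SIN_group G T \<longleftrightarrow>
     topological_group G T \<and>
     (\<forall>U \<in> nbhds_one G T. \<exists>V \<in> nbhds_one G T. \<forall>x \<in> carrier G.
        (\<lambda>v. inv\<^bsub>G\<^esub> x \<otimes>\<^bsub>G\<^esub> v \<otimes>\<^bsub>G\<^esub> x) ` V \<subseteq> U)"

definition NSnS_group :: "('a, 'b) monoid_scheme \<Rightarrow> 'a topology \<Rightarrow> bool" where
  "NSnS_group G T \<longleftrightarrow>
     topological_group G T \<and>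
     (\<exists>U \<in> nbhds_one G T. \<forall>N. N \<lhd> G \<and> N \<subseteq> U \<longrightarrow> N = {\<one>\<^bsub>G\<^esub>})"

end

theory Submission
  imports Defs
begin

text \<open>
  By the SIN property there is a sequence of conjugation-invariant symmetric neighborhoods
  \<open>W\<^sub>n\<close> of the neutral element with \<open>W\<^sub>n\<^sub>+\<^sub>1\<^sup>3 \<subseteq> W\<^sub>n\<close>, starting inside both the neighborhood
  witnessing local minimality and the one witnessing NSnS. Their intersection is a normal
  subgroup, hence trivial, so the Birkhoff--Kakutani construction turns the sequence into a
  bi-invariant metric. Its topology is a coarser Hausdorff group topology for which the
  neighborhood witnessing local minimality is still a neighborhood, so it is the given topology.
\<close>

section \<open>Real sums over lists, list products and conjugation in a group\<close>

text \<open>Take \<open>z\<close> to be the first entry at which the running sum reaches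
  \<open>c\<close>; the induction subtracts \<open>f a\<close> from \<open>c\<close> for every entry
  passed. The chain lemma uses this with \<open>c\<close> equal to half of the total.\<close>

lemma sum_list_split_at:
  fixes f :: "'a \<Rightarrow> real"
  assumes "xs \<noteq> []" "0 \<le> c" "c \<le> sum_list (map f xs)"
  shows "\<exists>ys z zs. xs = ys @ z # zs \<and> sum_list (map f ys) \<le> c \<and>
           sum_list (map f zs) \<le> sum_list (map f xs) - c"
  using assms
proof (induction xs arbitrary: c)
  case Nil
  then show ?case by simp
next
  case (Cons a as)
  show ?case
  proof (cases "c \<le> f a")
    case True
    then show ?thesis
      using Cons.prems by (intro exI[of _ "[]"] exI[of _ a] exI[of _ as]) auto
  next
    case False
    then have "as \<noteq> []" "0 \<le> c - f a" "c - f a \<le> sum_list (map f as)"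
      using Cons.prems by auto
    from Cons.IH[OF this] obtain ys z zs
      where "as = ys @ z # zs" "sum_list (map f ys) \<le> c - f a"
        "sum_list (map f zs) \<le> sum_list (map f as) - (c - f a)"
      by blast
    then show ?thesis
      by (intro exI[of _ "a # ys"] exI[of _ z] exI[of _ zs]) auto
  qed
qed

text \<open>The group may be non-abelian, so the order of factors matters and products are taken
  along lists.\<close>

definition list_prod :: "('a, 'b) monoid_scheme \<Rightarrow> 'a list \<Rightarrow> 'a" where
  "list_prod G xs = foldr (mult G) xs \<one>\<^bsub>G\<^esub>"

lemma list_prod_simps [simp]:
  "list_prod G [] = \<one>\<^bsub>G\<^esub>"
  "list_prod G (x # xs) = x \<otimes>\<^bsub>G\<^esub> list_prod G xs"
  by (simp_all add: list_prod_def)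

lemma (in monoid) list_prod_closed [simp]:
  "set xs \<subseteq> carrier G \<Longrightarrow> list_prod G xs \<in> carrier G"
  by (induction xs) auto

lemma (in monoid) list_prod_append:
  "set xs \<subseteq> carrier G \<Longrightarrow> set ys \<subseteq> carrier G \<Longrightarrow>
    list_prod G (xs @ ys) = list_prod G xs \<otimes> list_prod G ys"
  by (induction xs) (auto simp: m_assoc)

lemma (in group) inv_list_prod:
  "set xs \<subseteq> carrier G \<Longrightarrow> inv (list_prod G xs) = list_prod G (rev (map (\<lambda>x. inv x) xs))"
proof (induction xs)
  case (Cons a xs)
  moreover have "set (rev (map (\<lambda>x. inv x) xs)) \<subseteq> carrier G"
    using Cons.prems by auto
  ultimately show ?case
    using list_prod_append[of "rev (map (\<lambda>x. inv x) xs)" "[inv a]"]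
    by (auto simp: inv_mult_group)
qed simp

lemma (in group) conj_mult:
  assumes "x \<in> carrier G" "a \<in> carrier G" "b \<in> carrier G"
  shows "inv x \<otimes> (a \<otimes> b) \<otimes> x = (inv x \<otimes> a \<otimes> x) \<otimes> (inv x \<otimes> b \<otimes> x)"
proof -
  have "x \<otimes> (inv x \<otimes> (b \<otimes> x)) = b \<otimes> x"
    using assms by (simp flip: m_assoc)
  then show ?thesis using assms by (simp add: m_assoc)
qed

lemma (in group) conj_inv:
  assumes "x \<in> carrier G" "a \<in> carrier G"
  shows "inv (inv x \<otimes> a \<otimes> x) = inv x \<otimes> inv a \<otimes> x"
  using assms by (simp add: inv_mult_group m_assoc)

lemma (in group) conj_conj:
  assumes "x \<in> carrier G" "y \<in> carrier G" "a \<in> carrier G"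
  shows "inv x \<otimes> (inv y \<otimes> a \<otimes> y) \<otimes> x = inv (y \<otimes> x) \<otimes> a \<otimes> (y \<otimes> x)"
  using assms by (simp add: inv_mult_group m_assoc)

text \<open>Conjugation by \<open>x\<close> is a homomorphism. Hence it maps a factorization of an
  element, entry by entry, to a factorization of its conjugate.\<close>

lemma (in group) conj_list_prod:
  "x \<in> carrier G \<Longrightarrow> set xs \<subseteq> carrier G \<Longrightarrow>
    inv x \<otimes> list_prod G xs \<otimes> x = list_prod G (map (\<lambda>a. inv x \<otimes> a \<otimes> x) xs)"
proof (induction xs)
  case (Cons a xs)
  then have "inv x \<otimes> list_prod G (a # xs) \<otimes> x =
     (inv x \<otimes> a \<otimes> x) \<otimes> (inv x \<otimes> list_prod G xs \<otimes> x)"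
    using conj_mult[of x a "list_prod G xs"] by simp
  then show ?case using Cons by simp
qed simp

text \<open>Frink's chain lemma: split the product at the factor straddling half of the sum.\<close>

lemma (in group) list_prod_le_twice_sum:
  fixes f :: "'a \<Rightarrow> real"
  assumes one: "f \<one> = 0" and nonneg: "\<And>x. 0 \<le> f x"
    and triple: "\<And>x y z m. \<lbrakk>x \<in> carrier G; y \<in> carrier G; z \<in> carrier G;
                   f x \<le> m; f y \<le> m; f z \<le> m\<rbrakk> \<Longrightarrow> f (x \<otimes> (y \<otimes> z)) \<le> 2 * m"
    and "set xs \<subseteq> carrier G"
  shows "f (list_prod G xs) \<le> 2 * sum_list (map f xs)"
  using \<open>set xs \<subseteq> carrier G\<close>
proof (induction xs rule: length_induct)
  case (1 xs)
  let ?s = "sum_list (map f xs)"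
  have s: "0 \<le> sum_list (map f ys)" for ys
    using nonneg by (intro sum_list_nonneg) auto
  show ?case
  proof (cases "xs = []")
    case True
    then show ?thesis using one by simp
  next
    case False
    have "0 \<le> ?s / 2" "?s / 2 \<le> ?s"
      using s[of xs] by simp_all
    from sum_list_split_at[OF False this]
    obtain ys z zs where xs: "xs = ys @ z # zs"
      and ys: "sum_list (map f ys) \<le> ?s / 2" and zs: "sum_list (map f zs) \<le> ?s - ?s / 2"
      by blast
    have c: "set ys \<subseteq> carrier G" "z \<in> carrier G" "set zs \<subseteq> carrier G"
      using 1 xs by auto
    have "f (list_prod G ys) \<le> 2 * sum_list (map f ys)"
      "f (list_prod G zs) \<le> 2 * sum_list (map f zs)"
      using 1 c xs by auto
    \<comment> \<open>The straddling factor is bounded only by the whole sum, each outer product by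
      twice half of it. So \<open>triple\<close> applies with \<open>m\<close> equal to the whole
      sum, and the constant 2 is reproduced.\<close>
    moreover have "f z \<le> ?s"
      using s[of ys] s[of zs] xs by simp
    ultimately have "f (list_prod G ys \<otimes> (z \<otimes> list_prod G zs)) \<le> 2 * ?s"
      using ys zs c by (intro triple) auto
    then show ?thesis
      using c by (simp add: xs list_prod_append)
  qed
qed

section \<open>Bi-invariant norms from decreasing sequences of invariant sets\<close>

text \<open>Inversion and conjugation are required only not to increase \<open>N\<close>; applying
  them twice gives equality. Conjugation invariance is what will make the induced left-invariant
  distance right-invariant too.\<close>

locale bi_invariant_norm = group G for G (structure) +
  fixes N :: "'a \<Rightarrow> real"
  assumes N_nonneg: "x \<in> carrier G \<Longrightarrow> 0 \<le> N x"
    and N_zero: "x \<in> carrier G \<Longrightarrow> N x = 0 \<longleftrightarrow> x = \<one>"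
    and N_mult: "\<lbrakk>x \<in> carrier G; y \<in> carrier G\<rbrakk> \<Longrightarrow> N (x \<otimes> y) \<le> N x + N y"
    and N_inv_le: "x \<in> carrier G \<Longrightarrow> N (inv x) \<le> N x"
    and N_conj_le: "\<lbrakk>x \<in> carrier G; a \<in> carrier G\<rbrakk> \<Longrightarrow> N (inv x \<otimes> a \<otimes> x) \<le> N a"

text \<open>The sequence defines a dyadic gauge \<open>f\<close> that need not be subadditive.
  Passing to the infimum of \<open>f\<close>-sums over all factorizations gives subadditivity, and
  the chain lemma keeps this infimum between \<open>f / 2\<close> and \<open>f\<close>, so the sets
  \<open>W n\<close> are still recognized up to an index shift.\<close>

lemma (in group) bi_invariant_norm_exists:
  fixes W :: "nat \<Rightarrow> 'a set"
  assumes W_conj: "\<And>n x a. x \<in> carrier G \<Longrightarrow> a \<in> W n \<Longrightarrow> inv x \<otimes> a \<otimes> x \<in> W n"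
    and W_inv: "\<And>n a. a \<in> W n \<Longrightarrow> inv a \<in> W n"
    and W_carrier: "\<And>n. W n \<subseteq> carrier G"
    and W_triple: "\<And>n a b c. \<lbrakk>a \<in> W (Suc n); b \<in> W (Suc n); c \<in> W (Suc n)\<rbrakk> \<Longrightarrow>
                     a \<otimes> (b \<otimes> c) \<in> W n"
    and W_Inter: "(\<Inter>n. W n) = {\<one>}"
  shows "\<exists>N. bi_invariant_norm G N \<and> (\<forall>n. \<forall>x\<in>W n. N x < (1/2) ^ n) \<and>
           (\<forall>n. \<forall>x\<in>carrier G. N x < (1/2) ^ Suc n \<longrightarrow> x \<in> W n)"
proof -
  have one_W: "\<one> \<in> W n" for n
    using W_Inter by auto
  have "W (Suc n) \<subseteq> W n" for n
    using W_triple[OF _ one_W one_W] W_carrier[of "Suc n"] by force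
  then have W_anti: "W n \<subseteq> W m" if "m \<le> n" for m n
    using lift_Suc_antimono_le[of W] that by blast
  \<comment> \<open>The exponent is the first index at which \<open>x\<close> leaves the decreasing
    sequence, so \<open>W n\<close> is exactly the strict sublevel set at \<open>(1/2) ^ n\<close>.
    Points that never leave get 0; points outside \<open>W 0\<close>, in particular off the carrier,
    get 1.\<close>
  define f :: "'a \<Rightarrow> real"
    where "f x = (if \<forall>n. x \<in> W n then 0 else (1/2) ^ (LEAST n. x \<notin> W n))" for x
  have W_iff: "x \<in> W n \<longleftrightarrow> f x < (1/2) ^ n" for x n
  proof (cases "\<forall>n. x \<in> W n")
    case True
    then show ?thesis by (simp add: f_def)
  next
    case False
    then have L: "x \<notin> W (LEAST n. x \<notin> W n)"
      using LeastI_ex[of "\<lambda>n. x \<notin> W n"] by blast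
    have "x \<in> W n \<longleftrightarrow> n < (LEAST n. x \<notin> W n)"
      using L W_anti not_less_Least[of n "\<lambda>n. x \<notin> W n"] by (meson not_le_imp_less subsetD)
    moreover have "f x = (1/2) ^ (LEAST n. x \<notin> W n)"
      using False by (simp add: f_def)
    ultimately show ?thesis
      by simp
  qed
  have f_nonneg: "0 \<le> f x" for x
    by (simp add: f_def)
  have f_one: "f \<one> = 0"
    using one_W by (simp add: f_def)
  have f_zero: "x = \<one>" if "f x = 0" for x
  proof -
    have "x \<in> (\<Inter>n. W n)"
      using that by (simp add: W_iff)
    then show ?thesis
      using W_Inter by simp
  qed
  have f_le: "f y \<le> f x" if "\<And>n. x \<in> W n \<Longrightarrow> y \<in> W n" for x y
  proof (rule ccontr)
    assume "\<not> f y \<le> f x"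
    then have "f x < f y" by simp
    \<comment> \<open>The larger value is positive, hence a power of \<open>1/2\<close>; this
      \<open>n\<close> separates the two points, as \<open>x\<close> lies in \<open>W n\<close> and
      \<open>y\<close> does not.\<close>
    then obtain n where n: "f y = (1/2) ^ n"
      using f_nonneg[of x] by (auto simp: f_def split: if_splits)
    then have "x \<in> W n"
      using \<open>f x < f y\<close> by (simp add: W_iff)
    then show False
      using that[of n] n by (simp add: W_iff)
  qed
  have f_triple: "f (x \<otimes> (y \<otimes> z)) \<le> 2 * m"
    if "f x \<le> m" "f y \<le> m" "f z \<le> m" for x y z m
  proof (rule ccontr)
    assume *: "\<not> f (x \<otimes> (y \<otimes> z)) \<le> 2 * m"
    have "0 \<le> m" using f_nonneg[of x] that by linarith
    then obtain n where n: "f (x \<otimes> (y \<otimes> z)) = (1/2) ^ n"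
      using * by (auto simp: f_def split: if_splits)
    \<comment> \<open>The factor 2 is worth one index: all three factors lie in
      \<open>W (Suc n)\<close>, so the triple product cannot leave at \<open>n\<close>.\<close>
    then have "m < (1/2) ^ Suc n"
      using * by simp
    then have "x \<in> W (Suc n)" "y \<in> W (Suc n)" "z \<in> W (Suc n)"
      using that unfolding W_iff by linarith+
    then have "x \<otimes> (y \<otimes> z) \<in> W n"
      by (rule W_triple)
    then show False
      using n by (simp add: W_iff)
  qed
  \<comment> \<open>\<open>A x\<close> collects the factorizations of \<open>x\<close>; as
    concatenating them factors a product, the infimum over them is subadditive.\<close>
  define A where "A x = {xs. set xs \<subseteq> carrier G \<and> list_prod G xs = x}" for x
  define N where "N x = (INF xs\<in>A x. sum_list (map f xs))" for x
  have sum_nonneg: "0 \<le> sum_list (map f xs)" for xs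
    using f_nonneg by (intro sum_list_nonneg) auto
  have bdd: "bdd_below ((\<lambda>xs. sum_list (map f xs)) ` A x)" for x
    using sum_nonneg by (intro bdd_belowI[of _ 0]) auto
  have N_le: "N x \<le> sum_list (map f xs)" if "xs \<in> A x" for x xs
    unfolding N_def using bdd that by (rule cINF_lower)
  \<comment> \<open>The one-term factorization shows that the infimum is over a nonempty set, and
    also yields \<open>N x \<le> f x\<close>.\<close>
  have single: "[x] \<in> A x" if "x \<in> carrier G" for x
    using that by (simp add: A_def)
  have le_N: "c \<le> N x" if "x \<in> carrier G" "\<And>xs. xs \<in> A x \<Longrightarrow> c \<le> sum_list (map f xs)" for x c
    unfolding N_def using single[OF that(1)] that(2) by (intro cINF_greatest) auto
  have N_le_f: "N x \<le> f x" if "x \<in> carrier G" for x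
    using N_le[OF single[OF that]] by simp
  have f_le_N: "f x \<le> 2 * N x" if "x \<in> carrier G" for x
  proof -
    have "f x / 2 \<le> N x"
    proof (rule le_N[OF that])
      fix xs assume "xs \<in> A x"
      then show "f x / 2 \<le> sum_list (map f xs)"
        using list_prod_le_twice_sum[of f xs] f_one f_nonneg f_triple by (auto simp: A_def)
    qed
    then show ?thesis by simp
  qed
  show ?thesis
  proof (intro exI[of _ N] conjI allI ballI impI)
    show "bi_invariant_norm G N"
    proof
      fix x assume x: "x \<in> carrier G"
      show "0 \<le> N x"
        using x sum_nonneg by (intro le_N)
      show "N x = 0 \<longleftrightarrow> x = \<one>"
        using N_le_f[OF x] f_le_N[OF x] f_nonneg[of x] f_zero[of x] f_one by auto
      show "N (inv x) \<le> N x"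
      proof (rule le_N[OF x])
        fix xs assume xs: "xs \<in> A x"
        have "f (inv a) \<le> f a" for a
          using W_inv by (intro f_le)
        then have "sum_list (map f (rev (map (\<lambda>x. inv x) xs))) \<le> sum_list (map f xs)"
          by (simp add: rev_map sum_list_rev comp_def sum_list_mono flip: rev_map)
        \<comment> \<open>Inverting the entries and reversing their order factors
          \<open>inv x\<close>, at no greater cost because every \<open>W n\<close> is
          symmetric.\<close>
        moreover have "rev (map (\<lambda>x. inv x) xs) \<in> A (inv x)"
          using xs by (auto simp: A_def inv_list_prod)
        ultimately show "N (inv x) \<le> sum_list (map f xs)"
          using N_le by fastforce
      qed
      fix a assume a: "a \<in> carrier G"
      show "N (inv x \<otimes> a \<otimes> x) \<le> N a"
      proof (rule le_N[OF a])
        fix xs assume xs: "xs \<in> A a"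
        have "f (inv x \<otimes> b \<otimes> x) \<le> f b" for b
          using W_conj[OF x] by (intro f_le)
        then have "sum_list (map f (map (\<lambda>a. inv x \<otimes> a \<otimes> x) xs)) \<le> sum_list (map f xs)"
          by (simp add: comp_def sum_list_mono)
        moreover have "map (\<lambda>a. inv x \<otimes> a \<otimes> x) xs \<in> A (inv x \<otimes> a \<otimes> x)"
          using xs x by (auto simp: A_def conj_list_prod)
        ultimately show "N (inv x \<otimes> a \<otimes> x) \<le> sum_list (map f xs)"
          using N_le by fastforce
      qed
    next
      fix x y assume x: "x \<in> carrier G" and y: "y \<in> carrier G"
      \<comment> \<open>The two infima are taken one at a time: first over factorizations of
        \<open>y\<close> with \<open>xs\<close> fixed, then over \<open>xs\<close>.\<close>
      have "N (x \<otimes> y) - sum_list (map f xs) \<le> N y" if xs: "xs \<in> A x" for xs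
      proof (rule le_N[OF y])
        fix ys assume "ys \<in> A y"
        then have "xs @ ys \<in> A (x \<otimes> y)"
          using xs by (auto simp: A_def list_prod_append)
        from N_le[OF this] show "N (x \<otimes> y) - sum_list (map f xs) \<le> sum_list (map f ys)"
          by simp
      qed
      then have "N (x \<otimes> y) - N y \<le> N x"
        by (intro le_N[OF x]) (simp add: algebra_simps)
      then show "N (x \<otimes> y) \<le> N x + N y"
        by simp
    qed
  next
    fix n x assume "x \<in> W n"
    then show "N x < (1/2) ^ n"
      using N_le_f[of x] W_carrier[of n] by (force simp: W_iff)
  next
    \<comment> \<open>The constant 2 in \<open>f x \<le> 2 * N x\<close> costs the shift from
      \<open>n\<close> to \<open>Suc n\<close>.\<close>
    fix n x assume "x \<in> carrier G" "N x < (1/2) ^ Suc n"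
    then show "x \<in> W n"
      using f_le_N[of x] by (simp add: W_iff)
  qed
qed

section \<open>Neighborhoods of the neutral element and invariant sequences in SIN groups\<close>

lemma nbhds_one_mono:
  "A \<in> nbhds_one G T \<Longrightarrow> A \<subseteq> B \<Longrightarrow> B \<subseteq> carrier G \<Longrightarrow> B \<in> nbhds_one G T"
  unfolding nbhds_one_def by blast

lemma nbhds_one_Int:
  assumes "A \<in> nbhds_one G T" "B \<in> nbhds_one G T"
  shows "A \<inter> B \<in> nbhds_one G T"
proof -
  obtain U V where "openin T U" "\<one>\<^bsub>G\<^esub> \<in> U" "U \<subseteq> A" "openin T V" "\<one>\<^bsub>G\<^esub> \<in> V" "V \<subseteq> B"
    using assms unfolding nbhds_one_def by blast
  then show ?thesis
    using assms unfolding nbhds_one_def by (auto intro!: exI[of _ "U \<inter> V"])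
qed

lemma one_in_nbhds_one: "V \<in> nbhds_one G T \<Longrightarrow> \<one>\<^bsub>G\<^esub> \<in> V"
  unfolding nbhds_one_def by blast

lemma nbhds_one_square:
  assumes "topological_group G T" "U \<in> nbhds_one G T"
  obtains V where "V \<in> nbhds_one G T" "\<And>x y. x \<in> V \<Longrightarrow> y \<in> V \<Longrightarrow> x \<otimes>\<^bsub>G\<^esub> y \<in> U"
proof -
  interpret group G using assms by (simp add: topological_group_def)
  have T: "topspace T = carrier G"
    and cont: "continuous_map (prod_topology T T) T (\<lambda>(x, y). x \<otimes>\<^bsub>G\<^esub> y)"
    using assms by (auto simp: topological_group_def group_topology_def)
  obtain W where W: "openin T W" "\<one>\<^bsub>G\<^esub> \<in> W" "W \<subseteq> U"
    using assms(2) unfolding nbhds_one_def by blast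
  let ?P = "{p \<in> topspace (prod_topology T T). (\<lambda>(x, y). x \<otimes>\<^bsub>G\<^esub> y) p \<in> W}"
  have "openin (prod_topology T T) ?P"
    using cont W(1) by (rule openin_continuous_map_preimage)
  moreover have "(\<one>\<^bsub>G\<^esub>, \<one>\<^bsub>G\<^esub>) \<in> ?P"
    using W T by simp
  ultimately obtain A B where AB: "openin T A" "openin T B" "\<one>\<^bsub>G\<^esub> \<in> A" "\<one>\<^bsub>G\<^esub> \<in> B" "A \<times> B \<subseteq> ?P"
    unfolding openin_prod_topology_alt by meson
  show ?thesis
  proof (rule that)
    show "A \<inter> B \<in> nbhds_one G T"
      using AB T openin_subset[of T A] unfolding nbhds_one_def by blast
    show "x \<otimes>\<^bsub>G\<^esub> y \<in> U" if "x \<in> A \<inter> B" "y \<in> A \<inter> B" for x y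
    proof -
      have "(x, y) \<in> ?P"
        using AB(5) that by blast
      then show ?thesis
        using W(3) by auto
    qed
  qed
qed

lemma nbhds_one_inv:
  assumes "topological_group G T" "U \<in> nbhds_one G T"
  shows "{x \<in> carrier G. inv\<^bsub>G\<^esub> x \<in> U} \<in> nbhds_one G T"
proof -
  interpret group G using assms by (simp add: topological_group_def)
  have T: "topspace T = carrier G" and cont: "continuous_map T T (\<lambda>x. inv\<^bsub>G\<^esub> x)"
    using assms by (auto simp: topological_group_def group_topology_def)
  obtain W where W: "openin T W" "\<one>\<^bsub>G\<^esub> \<in> W" "W \<subseteq> U"
    using assms(2) unfolding nbhds_one_def by blast
  have "openin T {x \<in> topspace T. inv\<^bsub>G\<^esub> x \<in> W}"
    using cont W(1) by (rule openin_continuous_map_preimage)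
  then show ?thesis
    using W T unfolding nbhds_one_def by (auto intro!: exI[of _ "{x \<in> topspace T. inv\<^bsub>G\<^esub> x \<in> W}"])
qed

lemma SIN_group_refine:
  assumes "SIN_group G T" "U \<in> nbhds_one G T"
  obtains V where "V \<in> nbhds_one G T"
    and "\<And>x a. x \<in> carrier G \<Longrightarrow> a \<in> V \<Longrightarrow> inv\<^bsub>G\<^esub> x \<otimes>\<^bsub>G\<^esub> a \<otimes>\<^bsub>G\<^esub> x \<in> V"
    and "\<And>a. a \<in> V \<Longrightarrow> inv\<^bsub>G\<^esub> a \<in> V"
    and "\<And>a b c. \<lbrakk>a \<in> V; b \<in> V; c \<in> V\<rbrakk> \<Longrightarrow> a \<otimes>\<^bsub>G\<^esub> (b \<otimes>\<^bsub>G\<^esub> c) \<in> U"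
proof -
  have TG: "topological_group G T"
    using assms by (simp add: SIN_group_def)
  then interpret group G by (simp add: topological_group_def)
  obtain A where A: "A \<in> nbhds_one G T" "\<And>x y. x \<in> A \<Longrightarrow> y \<in> A \<Longrightarrow> x \<otimes>\<^bsub>G\<^esub> y \<in> U"
    using nbhds_one_square[OF TG assms(2)] by blast
  obtain B where B: "B \<in> nbhds_one G T" "\<And>x y. x \<in> B \<Longrightarrow> y \<in> B \<Longrightarrow> x \<otimes>\<^bsub>G\<^esub> y \<in> A"
    using nbhds_one_square[OF TG A(1)] by blast
  \<comment> \<open>Symmetric by construction. A first factor in \<open>A\<close> and two further
    factors in \<open>B\<close> multiply into \<open>U\<close>, since \<open>B\<close> squares into
    \<open>A\<close> and \<open>A\<close> into \<open>U\<close>.\<close>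
  define C where "C = (A \<inter> B) \<inter> {x \<in> carrier G. inv\<^bsub>G\<^esub> x \<in> A \<inter> B}"
  have C: "C \<in> nbhds_one G T"
    unfolding C_def using A B by (intro nbhds_one_Int nbhds_one_inv TG)
  have C_inv: "inv\<^bsub>G\<^esub> a \<in> C" if "a \<in> C" for a
    using that by (auto simp: C_def)
  obtain D where D: "D \<in> nbhds_one G T"
    "\<And>x. x \<in> carrier G \<Longrightarrow> (\<lambda>v. inv\<^bsub>G\<^esub> x \<otimes>\<^bsub>G\<^esub> v \<otimes>\<^bsub>G\<^esub> x) ` D \<subseteq> C"
    using assms(1) C unfolding SIN_group_def by meson
  \<comment> \<open>The intersection of all conjugates of \<open>C\<close>, its largest
    conjugation-invariant subset. SIN makes it a neighborhood, because it contains \<open>D\<close>;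
    symmetry passes from \<open>C\<close> to \<open>V\<close>.\<close>
  define V where "V = {v \<in> carrier G. \<forall>x\<in>carrier G. inv\<^bsub>G\<^esub> x \<otimes>\<^bsub>G\<^esub> v \<otimes>\<^bsub>G\<^esub> x \<in> C}"
  have V_C: "V \<subseteq> C"
  proof
    fix v assume "v \<in> V"
    then have "v \<in> carrier G" "inv\<^bsub>G\<^esub> \<one>\<^bsub>G\<^esub> \<otimes>\<^bsub>G\<^esub> v \<otimes>\<^bsub>G\<^esub> \<one>\<^bsub>G\<^esub> \<in> C"
      unfolding V_def by blast+
    then show "v \<in> C" by simp
  qed
  show ?thesis
  proof (rule that[of V])
    have "D \<subseteq> V"
      using D unfolding V_def nbhds_one_def by blast
    then show "V \<in> nbhds_one G T"
      by (rule nbhds_one_mono[OF D(1)]) (auto simp: V_def)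
  next
    fix x a assume "x \<in> carrier G" "a \<in> V"
    then show "inv\<^bsub>G\<^esub> x \<otimes>\<^bsub>G\<^esub> a \<otimes>\<^bsub>G\<^esub> x \<in> V"
      unfolding V_def by (auto simp: conj_conj)
  next
    fix a assume "a \<in> V"
    then show "inv\<^bsub>G\<^esub> a \<in> V"
      unfolding V_def using C_inv by (auto simp flip: conj_inv)
  next
    fix a b c assume "a \<in> V" "b \<in> V" "c \<in> V"
    then have "a \<in> A" "b \<in> B" "c \<in> B"
      using V_C unfolding C_def by blast+
    then show "a \<otimes>\<^bsub>G\<^esub> (b \<otimes>\<^bsub>G\<^esub> c) \<in> U"
      by (intro A(2) B(2))
  qed
qed

lemma SIN_group_invariant_sequence:
  assumes "SIN_group G T" "U \<in> nbhds_one G T"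
  obtains W :: "nat \<Rightarrow> 'a set"
  where "\<And>n. W n \<in> nbhds_one G T" and "W 0 \<subseteq> U"
    and "\<And>n x a. x \<in> carrier G \<Longrightarrow> a \<in> W n \<Longrightarrow> inv\<^bsub>G\<^esub> x \<otimes>\<^bsub>G\<^esub> a \<otimes>\<^bsub>G\<^esub> x \<in> W n"
    and "\<And>n a. a \<in> W n \<Longrightarrow> inv\<^bsub>G\<^esub> a \<in> W n"
    and "\<And>n a b c. \<lbrakk>a \<in> W (Suc n); b \<in> W (Suc n); c \<in> W (Suc n)\<rbrakk> \<Longrightarrow>
           a \<otimes>\<^bsub>G\<^esub> (b \<otimes>\<^bsub>G\<^esub> c) \<in> W n"
proof -
  interpret group G using assms by (simp add: SIN_group_def topological_group_def)
  define inv_nbhd where "inv_nbhd V \<longleftrightarrow> V \<in> nbhds_one G T \<and>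
    (\<forall>x\<in>carrier G. \<forall>a\<in>V. inv\<^bsub>G\<^esub> x \<otimes>\<^bsub>G\<^esub> a \<otimes>\<^bsub>G\<^esub> x \<in> V) \<and> (\<forall>a\<in>V. inv\<^bsub>G\<^esub> a \<in> V)" for V
  define triple where
    "triple V U \<longleftrightarrow> (\<forall>a\<in>V. \<forall>b\<in>V. \<forall>c\<in>V. a \<otimes>\<^bsub>G\<^esub> (b \<otimes>\<^bsub>G\<^esub> c) \<in> U)" for V U
  have step: "\<exists>V. inv_nbhd V \<and> triple V U" if U: "U \<in> nbhds_one G T" for U
  proof (rule SIN_group_refine[OF assms(1) U])
    fix V assume "V \<in> nbhds_one G T"
      "\<And>x a. x \<in> carrier G \<Longrightarrow> a \<in> V \<Longrightarrow> inv\<^bsub>G\<^esub> x \<otimes>\<^bsub>G\<^esub> a \<otimes>\<^bsub>G\<^esub> x \<in> V"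
      "\<And>a. a \<in> V \<Longrightarrow> inv\<^bsub>G\<^esub> a \<in> V"
      "\<And>a b c. \<lbrakk>a \<in> V; b \<in> V; c \<in> V\<rbrakk> \<Longrightarrow> a \<otimes>\<^bsub>G\<^esub> (b \<otimes>\<^bsub>G\<^esub> c) \<in> U"
    then show ?thesis
      by (intro exI[of _ V]) (simp add: inv_nbhd_def triple_def)
  qed
  \<comment> \<open>Dependent choice constrains successive terms only; the clause for
    \<open>n = 0\<close> ties the first term to \<open>U\<close>.\<close>
  have "\<exists>W. \<forall>n. (inv_nbhd (W n) \<and> (n = 0 \<longrightarrow> triple (W n) U)) \<and> triple (W (Suc n)) (W n)"
  proof (rule dependent_nat_choice)
    show "\<exists>V. inv_nbhd V \<and> (0 = (0::nat) \<longrightarrow> triple V U)"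
      using step[OF assms(2)] by simp
  next
    fix V and n :: nat
    assume "inv_nbhd V \<and> (n = 0 \<longrightarrow> triple V U)"
    then have "V \<in> nbhds_one G T"
      by (simp add: inv_nbhd_def)
    from step[OF this]
    show "\<exists>V'. (inv_nbhd V' \<and> (Suc n = 0 \<longrightarrow> triple V' U)) \<and> triple V' V"
      by simp
  qed
  then obtain W where W: "\<And>n. inv_nbhd (W n)" "triple (W 0) U" "\<And>n. triple (W (Suc n)) (W n)"
    by blast
  show ?thesis
  proof (rule that[of W])
    show "W 0 \<subseteq> U"
    proof
      fix a assume a: "a \<in> W 0"
      have "W 0 \<in> nbhds_one G T"
        using W(1) by (simp add: inv_nbhd_def)
      then have "\<one>\<^bsub>G\<^esub> \<in> W 0" "a \<in> carrier G"
        using a one_in_nbhds_one by (auto simp: nbhds_one_def)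
      \<comment> \<open>Write \<open>a\<close> as the triple product of \<open>a\<close>,
        \<open>\<one>\<close> and \<open>\<one>\<close>.\<close>
      then show "a \<in> U"
        using W(2) a unfolding triple_def by force
    qed
  qed (use W in \<open>auto simp: inv_nbhd_def triple_def\<close>)
qed

lemma (in group) normal_Inter_invariant_sequence:
  fixes W :: "nat \<Rightarrow> 'a set"
  assumes "\<And>n x a. x \<in> carrier G \<Longrightarrow> a \<in> W n \<Longrightarrow> inv x \<otimes> a \<otimes> x \<in> W n"
    and "\<And>n a. a \<in> W n \<Longrightarrow> inv a \<in> W n"
    and W_carrier: "\<And>n. W n \<subseteq> carrier G" and one_W: "\<And>n. \<one> \<in> W n"
    and W_triple: "\<And>n a b c. \<lbrakk>a \<in> W (Suc n); b \<in> W (Suc n); c \<in> W (Suc n)\<rbrakk> \<Longrightarrow>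
                     a \<otimes> (b \<otimes> c) \<in> W n"
  shows "(\<Inter>n. W n) \<lhd> G"
proof (rule normal_invI)
  \<comment> \<open>A single \<open>W n\<close> need not be closed under products, but elements of
    the intersection also lie in \<open>W (Suc n)\<close>; the third factor is
    \<open>\<one>\<close>.\<close>
  have "a \<otimes> b \<in> W n" if "\<And>n. a \<in> W n" "\<And>n. b \<in> W n" for a b n
    using W_triple[OF that(1) that(2) one_W] that(2) W_carrier by force
  then show "subgroup (\<Inter>n. W n) G"
    using assms W_carrier[THEN subsetD] by (intro subgroup.intro) auto
  show "x \<otimes> h \<otimes> inv x \<in> (\<Inter>n. W n)" if "x \<in> carrier G" "h \<in> (\<Inter>n. W n)" for x h
    using assms(1)[of "inv x" h] that by auto
qed

text \<open>The set is the translate of \<open>U\<close> by \<open>x\<close>, written as a preimage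
  under translation by \<open>inv x\<close> so that continuity applies. It carries information at
  the neutral element to every other point.\<close>

lemma openin_left_translate:
  assumes "topological_group G T" "openin T U" "x \<in> carrier G"
  shows "openin T {y \<in> carrier G. inv\<^bsub>G\<^esub> x \<otimes>\<^bsub>G\<^esub> y \<in> U}"
proof -
  interpret group G using assms by (simp add: topological_group_def)
  have T: "topspace T = carrier G"
    and cont: "continuous_map (prod_topology T T) T (\<lambda>(x, y). x \<otimes>\<^bsub>G\<^esub> y)"
    using assms by (auto simp: topological_group_def group_topology_def)
  have "continuous_map T (prod_topology T T) (\<lambda>y. (inv\<^bsub>G\<^esub> x, y))"
    using assms T by (intro continuous_map_pairedI) auto
  from continuous_map_compose[OF this cont]
  have "continuous_map T T (\<lambda>y. inv\<^bsub>G\<^esub> x \<otimes>\<^bsub>G\<^esub> y)"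
    by (simp add: comp_def)
  from openin_continuous_map_preimage[OF this assms(2)] show ?thesis
    by (simp add: T)
qed

section \<open>The metric group topology of a bi-invariant norm\<close>

context bi_invariant_norm
begin

lemma N_inv: "x \<in> carrier G \<Longrightarrow> N (inv x) = N x"
  using N_inv_le[of x] N_inv_le[of "inv x"] by simp

lemma N_conj:
  assumes "x \<in> carrier G" "a \<in> carrier G"
  shows "N (inv x \<otimes> a \<otimes> x) = N a"
proof (rule antisym)
  have "inv (inv x) \<otimes> (inv x \<otimes> a \<otimes> x) \<otimes> inv x = a"
    using conj_conj[of "inv x" x a] assms by simp
  then show "N a \<le> N (inv x \<otimes> a \<otimes> x)"
    using N_conj_le[of "inv x" "inv x \<otimes> a \<otimes> x"] assms by simp
qed (rule N_conj_le[OF assms])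

text \<open>The axioms of \<^locale>\<open>Metric_space\<close> demand symmetry and nonnegativity on the whole type,
  hence the junk value \<open>0\<close> off the carrier.\<close>

definition ndist :: "'a \<Rightarrow> 'a \<Rightarrow> real" where
  "ndist x y = (if x \<in> carrier G \<and> y \<in> carrier G then N (inv x \<otimes> y) else 0)"

sublocale Metric_space "carrier G" ndist
proof
  show "0 \<le> ndist x y" for x y
    by (simp add: ndist_def N_nonneg)
  show "ndist x y = ndist y x" for x y
    using N_inv[of "inv x \<otimes> y"] by (auto simp: ndist_def inv_mult_group)
next
  fix x y assume xy: "x \<in> carrier G" "y \<in> carrier G"
  then have "inv x \<otimes> y = \<one> \<longleftrightarrow> x = y"
    by (metis inv_closed inv_equality inv_inv l_inv)
  then show "ndist x y = 0 \<longleftrightarrow> x = y"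
    using xy by (simp add: ndist_def N_zero)
next
  fix x y z assume "x \<in> carrier G" "y \<in> carrier G" "z \<in> carrier G"
  moreover from this have "inv x \<otimes> z = (inv x \<otimes> y) \<otimes> (inv y \<otimes> z)"
    by (simp add: m_assoc inv_solve_left flip: m_assoc[of y])
  ultimately show "ndist x z \<le> ndist x y + ndist y z"
    by (simp add: ndist_def N_mult)
qed

text \<open>The quotient of the two products is a conjugate of \<open>inv x \<otimes> x'\<close> by
  \<open>y\<close>, times \<open>inv y \<otimes> y'\<close>. Conjugation invariance removes the
  dependence on \<open>y\<close>.\<close>

lemma ndist_mult:
  assumes "x \<in> carrier G" "y \<in> carrier G" "x' \<in> carrier G" "y' \<in> carrier G"
  shows "ndist (x \<otimes> y) (x' \<otimes> y') \<le> ndist x x' + ndist y y'"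
proof -
  have "inv (x \<otimes> y) \<otimes> (x' \<otimes> y') = (inv y \<otimes> (inv x \<otimes> x') \<otimes> y) \<otimes> (inv y \<otimes> y')"
    using assms by (simp add: inv_mult_group m_assoc flip: m_assoc[of y "inv y"])
  then show ?thesis
    using assms N_mult[of "inv y \<otimes> (inv x \<otimes> x') \<otimes> y" "inv y \<otimes> y'"]
    by (simp add: ndist_def N_conj)
qed

text \<open>Inversion exchanges left and right quotients, and \<open>x \<otimes> inv y\<close> is a
  conjugate of \<open>inv y \<otimes> x\<close>.\<close>

lemma ndist_inv:
  assumes "x \<in> carrier G" "y \<in> carrier G"
  shows "ndist (inv x) (inv y) = ndist x y"
proof -
  have "inv (inv y) \<otimes> (inv y \<otimes> x) \<otimes> inv y = x \<otimes> inv y"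
    using assms by (simp flip: m_assoc)
  then have "ndist (inv x) (inv y) = ndist y x"
    using assms N_conj[of "inv y" "inv y \<otimes> x"] by (simp add: ndist_def)
  then show ?thesis by (simp add: commute)
qed

lemma group_topology_mtopology: "group_topology G mtopology"
  unfolding group_topology_def
proof (intro conjI)
  show "continuous_map (prod_topology mtopology mtopology) mtopology (\<lambda>(x, y). x \<otimes> y)"
    unfolding continuous_map_to_metric
  proof (intro ballI allI impI)
    fix p and e :: real
    assume p: "p \<in> topspace (prod_topology mtopology mtopology)" and e: "0 < e"
    obtain x y where xy: "p = (x, y)" "x \<in> carrier G" "y \<in> carrier G"
      using p by auto
    have "x' \<otimes> y' \<in> mball (x \<otimes> y) e" if "x' \<in> mball x (e/2)" "y' \<in> mball y (e/2)" for x' y'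
      using that ndist_mult[of x y x' y'] xy by auto
    then show "\<exists>U. openin (prod_topology mtopology mtopology) U \<and> p \<in> U \<and>
        (\<forall>q\<in>U. (case q of (x, y) \<Rightarrow> x \<otimes> y) \<in> mball (case p of (x, y) \<Rightarrow> x \<otimes> y) e)"
      using xy e
      by (intro exI[of _ "mball x (e/2) \<times> mball y (e/2)"])
         (auto simp: openin_prod_Times_iff simp del: in_mball)
  qed
  show "continuous_map mtopology mtopology (\<lambda>x. inv x)"
    unfolding continuous_map_to_metric
  proof (intro ballI allI impI)
    fix x and e :: real
    assume "x \<in> topspace mtopology" "0 < e"
    then show "\<exists>U. openin mtopology U \<and> x \<in> U \<and> (\<forall>y\<in>U. inv y \<in> mball (inv x) e)"
      by (intro exI[of _ "mball x e"]) (auto simp: ndist_inv)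
  qed
qed simp

text \<open>By left invariance of the distance, a \<open>T\<close>-open set around
  \<open>\<one>\<close> on which \<open>N\<close> is below \<open>e\<close> translates into the ball
  of radius \<open>e\<close> about any point.\<close>

lemma mtopology_coarser:
  assumes "topological_group G T"
    and small: "\<And>e. 0 < e \<Longrightarrow> \<exists>V \<in> nbhds_one G T. \<forall>x\<in>V. N x < e"
  shows "coarser_topology mtopology T"
  unfolding coarser_topology_def
proof (intro allI impI)
  fix U assume U: "openin mtopology U"
  show "openin T U"
  proof (subst openin_subopen, intro ballI)
    fix x assume "x \<in> U"
    then obtain e where x: "x \<in> carrier G" and e: "0 < e" "mball x e \<subseteq> U"
      using U unfolding openin_mtopology by blast
    obtain W where W: "openin T W" "\<one> \<in> W" "\<And>y. y \<in> W \<Longrightarrow> N y < e"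
      using small[OF e(1)] unfolding nbhds_one_def by blast
    let ?O = "{y \<in> carrier G. inv x \<otimes> y \<in> W}"
    have "openin T ?O"
      using assms(1) W(1) x by (rule openin_left_translate)
    moreover have "x \<in> ?O"
      using x W by simp
    moreover have "?O \<subseteq> mball x e"
      using x W(3) by (auto simp: ndist_def)
    ultimately show "\<exists>O'. openin T O' \<and> x \<in> O' \<and> O' \<subseteq> U"
      using e(2) by blast
  qed
qed

lemma nbhds_one_mtopology:
  assumes "0 < e" "V \<subseteq> carrier G" "\<And>x. x \<in> carrier G \<Longrightarrow> N x < e \<Longrightarrow> x \<in> V"
  shows "V \<in> nbhds_one G mtopology"
proof -
  have "mball \<one> e \<subseteq> V"
    using assms(3) by (auto simp: ndist_def)
  then show ?thesis
    using assms(1,2) unfolding nbhds_one_def by (auto intro: exI[of _ "mball \<one> e"])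
qed

end

section \<open>Local minimality applied to the norm topology\<close>

theorem proposition2p13:
  fixes G :: "('a, 'b) monoid_scheme" and T :: "'a topology"
  assumes "locally_minimal_group G T"
    and "SIN_group G T"
    and "NSnS_group G T"
  shows "metrizable_space T"
proof -
  have TG: "topological_group G T"
    using assms(2) by (simp add: SIN_group_def)
  then interpret group G by (simp add: topological_group_def)
  obtain V where V: "V \<in> nbhds_one G T"
    and min: "\<And>S. \<lbrakk>group_topology G S; Hausdorff_space S; coarser_topology S T; V \<in> nbhds_one G S\<rbrakk>
                \<Longrightarrow> S = T"
    using assms(1) unfolding locally_minimal_group_def by blast
  obtain U where U: "U \<in> nbhds_one G T" and triv: "\<And>K. K \<lhd> G \<Longrightarrow> K \<subseteq> U \<Longrightarrow> K = {\<one>\<^bsub>G\<^esub>}"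
    using assms(3) unfolding NSnS_group_def by blast
  \<comment> \<open>Starting inside \<open>U \<inter> V\<close> serves both purposes:
    \<open>U\<close> makes the intersection of the sequence trivial, \<open>V\<close> lets local
    minimality apply.\<close>
  obtain W where W: "\<And>n. W n \<in> nbhds_one G T" "W 0 \<subseteq> U \<inter> V"
    "\<And>n x a. x \<in> carrier G \<Longrightarrow> a \<in> W n \<Longrightarrow> inv\<^bsub>G\<^esub> x \<otimes>\<^bsub>G\<^esub> a \<otimes>\<^bsub>G\<^esub> x \<in> W n"
    "\<And>n a. a \<in> W n \<Longrightarrow> inv\<^bsub>G\<^esub> a \<in> W n"
    "\<And>n a b c. \<lbrakk>a \<in> W (Suc n); b \<in> W (Suc n); c \<in> W (Suc n)\<rbrakk> \<Longrightarrow>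
       a \<otimes>\<^bsub>G\<^esub> (b \<otimes>\<^bsub>G\<^esub> c) \<in> W n"
    using SIN_group_invariant_sequence[OF assms(2) nbhds_one_Int[OF U V]] by blast
  have W_carrier: "W n \<subseteq> carrier G" for n
    using W(1)[of n] by (simp add: nbhds_one_def)
  have "(\<Inter>n. W n) \<lhd> G"
    using W(3,4) W_carrier one_in_nbhds_one[OF W(1)] W(5) by (rule normal_Inter_invariant_sequence)
  then have W_Inter: "(\<Inter>n. W n) = {\<one>\<^bsub>G\<^esub>}"
    using W(2) by (intro triv) auto
  have "\<exists>N. bi_invariant_norm G N \<and> (\<forall>n. \<forall>x\<in>W n. N x < (1/2) ^ n) \<and>
          (\<forall>n. \<forall>x\<in>carrier G. N x < (1/2) ^ Suc n \<longrightarrow> x \<in> W n)"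
    using W(3,4) W_carrier W(5) W_Inter by (rule bi_invariant_norm_exists)
  then obtain N where N: "bi_invariant_norm G N"
    and small: "\<And>n x. x \<in> W n \<Longrightarrow> N x < (1/2) ^ n"
    and large: "\<And>n x. x \<in> carrier G \<Longrightarrow> N x < (1/2) ^ Suc n \<Longrightarrow> x \<in> W n"
    by blast
  interpret bi_invariant_norm G N by (rule N)
  \<comment> \<open>The \<open>W n\<close> are not known to form a base of \<open>T\<close> at
    \<open>\<one>\<close>; that the norm topology is all of \<open>T\<close> comes from local
    minimality.\<close>
  have "mtopology = T"
  proof (rule min)
    show "group_topology G mtopology"
      by (rule group_topology_mtopology)
    show "Hausdorff_space mtopology"
      by (rule Hausdorff_space_mtopology)
    show "coarser_topology mtopology T"
    proof (rule mtopology_coarser[OF TG])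
      fix e :: real assume "0 < e"
      then obtain n where "(1/2) ^ n < e"
        using real_arch_pow_inv[of e "1/2"] by auto
      then show "\<exists>V\<in>nbhds_one G T. \<forall>x\<in>V. N x < e"
        using W(1) small by (meson less_trans)
    qed
    show "V \<in> nbhds_one G mtopology"
    proof (rule nbhds_one_mtopology)
      show "V \<subseteq> carrier G"
        using V by (simp add: nbhds_one_def)
      \<comment> \<open>The ball of radius \<open>1/2\<close> about \<open>\<one>\<close> lies in
        \<open>W 0\<close>, hence in \<open>V\<close>.\<close>
      show "x \<in> V" if "x \<in> carrier G" "N x < (1/2) ^ Suc 0" for x
        using large[OF that] W(2) by blast
    qed simp
  qed
  then show ?thesis
    using metrizable_space_mtopology by simp
qed

end
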